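(* Let $\mathcal{H}$ be a separable Hilbert space with orthonormal basis $\{e_j\}_{j\in J}$, $K\in B(\mathcal{H})$ an operator with closed range, and $W=\{(W_i,\omega_i)\}_{i\in I}$ a $K$-fusion frame for $\mathcal{H}$ with bounds $A$ and $B$. A Bessel fusion sequence $V=\{(V_i,\upsilon_i)\}_{i\in I}$ is a $K$-dual of $W$ if and only if $G=\{\upsilon_i\pi_{V_i}e_j\}_{i\in I,j\in J}$ is a $K$-dual of $F=\{\omega_i\pi_{R(K)}\pi_{W_i}(S_W^{-1})^*Ke_j\}_{i\in I,j\in J}$.
   Context: $I$ is a countable index set; $R(T)$ is the range of $T$; $\pi_U$ is the orthogonal projection of $\mathcal{H}$ onto a closed subspace $U$. A family $\{(W_i,\omega_i)\}_{i\in I}$ of closed subspaces with weights $\omega_i>0$ is a Bessel fusion sequence if there is $B<\infty$ with $\sum_i\omega_i^2\|\pi_{W_i}f\|^2\le B\|f\|^2$ for all $f\in\mathcal{H}$, and a $K$-fusion frame with bounds $A,B$ if moreover $A>0$ and $A\|K^*f\|^2\le\sum_i\omega_i^2\|\pi_{W_i}f\|^2$ for all $f$. The frame operator is $S_Wf=\sum_i\omega_i^2\pi_{W_i}f$. When $K$ has closed range and $W$ is a $K$-fusion frame, $S_W(R(K))$ is closed and the restriction $S_W:R(K)\to S_W(R(K))$ is invertible with bounded inverse; $S_W^{-1}:S_W(R(K))\to R(K)$ denotes this inverse and $(S_W^{-1})^*:R(K)\to S_W(R(K))$ its adjoint. A Bessel fusion sequence $V=\{(V_i,\upsilon_i)\}_{i\in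 I}$ is a $K$-dual of the $K$-fusion frame $W$ if $Kf=\sum_{i\in I}\omega_i\upsilon_i\,\pi_{R(K)}\pi_{W_i}(S_W^{-1})^*K\pi_{V_i}f$ for all $f\in\mathcal{H}$. For sequences of vectors: a Bessel sequence $\{g_k\}_k\subseteq\mathcal{H}$ is a $K$-dual of $\{f_k\}_k\subseteq\mathcal{H}$ if $Kf=\sum_k\langle f,g_k\rangle f_k$ for all $f\in\mathcal{H}$. *)

theory Defs
  imports "HOL-Analysis.Analysis" "Jordan_Normal_Form.Conjugate"
begin

text \<open>
  The scalars of a Hilbert space are either the reals or the complex numbers; the following class
  covers exactly these two cases (as normed fields with conjugation), so that statements over it
  hold for real and for complex Hilbert spaces.
\<close>

class hilbert_scalar = real_normed_field + conjugatable_field +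
  assumes mult_conjugate: "z * conjugate z = scaleR ((norm z)\<^sup>2) 1"

instance real :: hilbert_scalar
  by standard (simp add: power2_eq_square)

instance complex :: hilbert_scalar
  by standard (simp add: complex_norm_square[symmetric] scaleR_conv_of_real)

text \<open>
  The inner product is linear in its first argument. Completeness is part of the type class of the
  vectors, and the last assumption makes its norm the one induced by the inner product.
\<close>

locale hilbert_space = vector_space smul
  for smul :: "'k::hilbert_scalar \<Rightarrow> 'a::banach \<Rightarrow> 'a" +
  fixes ip :: "'a \<Rightarrow> 'a \<Rightarrow> 'k"
  assumes scale_of_real: "smul (of_real r) x = r *\<^sub>R x"
    and ip_add_left: "ip (x + y) z = ip x z + ip y z"
    and ip_scale_left: "ip (smul c x) y = c * ip x y"
    and ip_commute: "ip x y = conjugate (ip y x)"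
    and ip_self: "ip x x = of_real ((norm x)\<^sup>2)"

lemma hilbert_space_real: "hilbert_space (*) (\<lambda>x y :: real. x * y)"
  by unfold_locales (simp_all add: algebra_simps power2_eq_square)

lemma hilbert_space_complex: "hilbert_space (*) (\<lambda>x y :: complex. x * cnj y)"
  by unfold_locales
    (simp_all add: algebra_simps scaleR_conv_of_real complex_norm_square[symmetric])

definition orthonormal_basis ::
  "('k::hilbert_scalar \<Rightarrow> 'a::banach \<Rightarrow> 'a) \<Rightarrow> ('a \<Rightarrow> 'a \<Rightarrow> 'k) \<Rightarrow> 'j set \<Rightarrow> ('j \<Rightarrow> 'a) \<Rightarrow> bool" where
  "orthonormal_basis smul ip J e \<longleftrightarrow>
     (\<forall>j\<in>J. \<forall>k\<in>J. ip (e j) (e k) = (if j = k then 1 else 0)) \<and>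
     closure (module.span smul (e ` J)) = UNIV"

definition bounded_operator ::
  "('k::hilbert_scalar \<Rightarrow> 'a::banach \<Rightarrow> 'a) \<Rightarrow> ('a \<Rightarrow> 'a) \<Rightarrow> bool" where
  "bounded_operator smul T \<longleftrightarrow>
     Vector_Spaces.linear smul smul T \<and> (\<exists>C. \<forall>x. norm (T x) \<le> C * norm x)"

definition closed_subspace ::
  "('k::hilbert_scalar \<Rightarrow> 'a::banach \<Rightarrow> 'a) \<Rightarrow> 'a set \<Rightarrow> bool" where
  "closed_subspace smul U \<longleftrightarrow> module.subspace smul U \<and> closed U"

text \<open>Meaningful when \<open>U\<close> is a closed subspace.\<close>

definition proj :: "('a::banach \<Rightarrow> 'a \<Rightarrow> 'k::hilbert_scalar) \<Rightarrow> 'a set \<Rightarrow> 'a \<Rightarrow> 'a" where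
  "proj ip U x = (THE p. p \<in> U \<and> (\<forall>u\<in>U. ip (x - p) u = 0))"

text \<open>
  For a bounded linear \<open>T : M \<rightarrow> N\<close> between subspaces with \<open>M\<close> closed, \<open>adj_on ip M T\<close> is the adjoint
  \<open>T\<^sup>* : N \<rightarrow> M\<close>: by Riesz, \<open>T\<^sup>* y\<close> for \<open>y \<in> N\<close> is the unique element \<open>z\<close> of \<open>M\<close> representing the
  functional \<open>x \<mapsto> \<langle>T x, y\<rangle>\<close> on \<open>M\<close>. The case \<open>M = UNIV\<close> is the usual adjoint.
\<close>

definition adj_on ::
  "('a::banach \<Rightarrow> 'a \<Rightarrow> 'k::hilbert_scalar) \<Rightarrow> 'a set \<Rightarrow> ('a \<Rightarrow> 'a) \<Rightarrow> 'a \<Rightarrow> 'a" where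
  "adj_on ip M T y = (THE z. z \<in> M \<and> (\<forall>x\<in>M. ip (T x) y = ip x z))"

definition fusion_bessel ::
  "('k::hilbert_scalar \<Rightarrow> 'a::banach \<Rightarrow> 'a) \<Rightarrow> ('a \<Rightarrow> 'a \<Rightarrow> 'k) \<Rightarrow>
     'i set \<Rightarrow> ('i \<Rightarrow> 'a set) \<Rightarrow> ('i \<Rightarrow> real) \<Rightarrow> real \<Rightarrow> bool" where
  "fusion_bessel smul ip I W \<omega> B \<longleftrightarrow>
     (\<forall>i\<in>I. closed_subspace smul (W i) \<and> \<omega> i > 0) \<and>
     (\<forall>f. (\<lambda>i. (\<omega> i)\<^sup>2 * (norm (proj ip (W i) f))\<^sup>2) summable_on I \<and>
          (\<Sum>\<^sub>\<infinity>i\<in>I. (\<omega> i)\<^sup>2 * (norm (proj ip (W i) f))\<^sup>2) \<le> B * (norm f)\<^sup>2)"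

definition bessel_fusion_sequence ::
  "('k::hilbert_scalar \<Rightarrow> 'a::banach \<Rightarrow> 'a) \<Rightarrow> ('a \<Rightarrow> 'a \<Rightarrow> 'k) \<Rightarrow>
     'i set \<Rightarrow> ('i \<Rightarrow> 'a set) \<Rightarrow> ('i \<Rightarrow> real) \<Rightarrow> bool" where
  "bessel_fusion_sequence smul ip I W \<omega> \<longleftrightarrow> (\<exists>B. fusion_bessel smul ip I W \<omega> B)"

definition K_fusion_frame ::
  "('k::hilbert_scalar \<Rightarrow> 'a::banach \<Rightarrow> 'a) \<Rightarrow> ('a \<Rightarrow> 'a \<Rightarrow> 'k) \<Rightarrow> ('a \<Rightarrow> 'a) \<Rightarrow>
     'i set \<Rightarrow> ('i \<Rightarrow> 'a set) \<Rightarrow> ('i \<Rightarrow> real) \<Rightarrow> real \<Rightarrow> real \<Rightarrow> bool" where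
  "K_fusion_frame smul ip K I W \<omega> A B \<longleftrightarrow>
     fusion_bessel smul ip I W \<omega> B \<and> A > 0 \<and>
     (\<forall>f. A * (norm (adj_on ip UNIV K f))\<^sup>2 \<le>
          (\<Sum>\<^sub>\<infinity>i\<in>I. (\<omega> i)\<^sup>2 * (norm (proj ip (W i) f))\<^sup>2))"

definition frame_operator ::
  "('a::banach \<Rightarrow> 'a \<Rightarrow> 'k::hilbert_scalar) \<Rightarrow>
     'i set \<Rightarrow> ('i \<Rightarrow> 'a set) \<Rightarrow> ('i \<Rightarrow> real) \<Rightarrow> 'a \<Rightarrow> 'a" where
  "frame_operator ip I W \<omega> f = (\<Sum>\<^sub>\<infinity>i\<in>I. (\<omega> i)\<^sup>2 *\<^sub>R proj ip (W i) f)"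

text \<open>
  \<open>(S\<^sub>W\<^sup>-\<^sup>1)\<^sup>* : R(K) \<rightarrow> S\<^sub>W(R(K))\<close>, where \<open>S\<^sub>W\<^sup>-\<^sup>1 : S\<^sub>W(R(K)) \<rightarrow> R(K)\<close> inverts the restriction of
  \<open>S\<^sub>W\<close> to \<open>R(K)\<close>.
\<close>

definition frame_inv_adj ::
  "('a::banach \<Rightarrow> 'a \<Rightarrow> 'k::hilbert_scalar) \<Rightarrow> ('a \<Rightarrow> 'a) \<Rightarrow>
     'i set \<Rightarrow> ('i \<Rightarrow> 'a set) \<Rightarrow> ('i \<Rightarrow> real) \<Rightarrow> 'a \<Rightarrow> 'a" where
  "frame_inv_adj ip K I W \<omega> =
     adj_on ip (frame_operator ip I W \<omega> ` range K)
       (inv_into (range K) (frame_operator ip I W \<omega>))"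

definition fusion_K_dual ::
  "('k::hilbert_scalar \<Rightarrow> 'a::banach \<Rightarrow> 'a) \<Rightarrow> ('a \<Rightarrow> 'a \<Rightarrow> 'k) \<Rightarrow> ('a \<Rightarrow> 'a) \<Rightarrow> 'i set \<Rightarrow>
     ('i \<Rightarrow> 'a set) \<Rightarrow> ('i \<Rightarrow> real) \<Rightarrow> ('i \<Rightarrow> 'a set) \<Rightarrow> ('i \<Rightarrow> real) \<Rightarrow> bool" where
  "fusion_K_dual smul ip K I W \<omega> V \<upsilon> \<longleftrightarrow>
     bessel_fusion_sequence smul ip I V \<upsilon> \<and>
     (\<forall>f. ((\<lambda>i. (\<omega> i * \<upsilon> i) *\<^sub>R
            proj ip (range K) (proj ip (W i) (frame_inv_adj ip K I W \<omega> (K (proj ip (V i) f)))))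
          has_sum K f) I)"

definition bessel_sequence ::
  "('a::banach \<Rightarrow> 'a \<Rightarrow> 'k::hilbert_scalar) \<Rightarrow> 'n set \<Rightarrow> ('n \<Rightarrow> 'a) \<Rightarrow> bool" where
  "bessel_sequence ip N g \<longleftrightarrow>
     (\<exists>B. \<forall>f. (\<lambda>k. (norm (ip f (g k)))\<^sup>2) summable_on N \<and>
              (\<Sum>\<^sub>\<infinity>k\<in>N. (norm (ip f (g k)))\<^sup>2) \<le> B * (norm f)\<^sup>2)"

text \<open>The sequence \<open>g\<close> is a \<open>K\<close>-dual of the sequence \<open>h\<close>.\<close>

definition vector_K_dual ::
  "('k::hilbert_scalar \<Rightarrow> 'a::banach \<Rightarrow> 'a) \<Rightarrow> ('a \<Rightarrow> 'a \<Rightarrow> 'k) \<Rightarrow> ('a \<Rightarrow> 'a) \<Rightarrow> 'n set \<Rightarrow>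
     ('n \<Rightarrow> 'a) \<Rightarrow> ('n \<Rightarrow> 'a) \<Rightarrow> bool" where
  "vector_K_dual smul ip K N h g \<longleftrightarrow>
     bessel_sequence ip N g \<and>
     (\<forall>f. ((\<lambda>k. smul (ip f (g k)) (h k)) has_sum K f) N)"

end

theory Submission
  imports Defs
begin

text \<open>
  Write \<open>T\<^sub>i = \<pi>\<^bsub>R(K)\<^esub> \<pi>\<^bsub>W i\<^esub> (S\<^sub>W\<^sup>-\<^sup>1)\<^sup>* K\<close>. The pairing of \<open>f\<close> with \<open>\<upsilon> i \<pi>\<^bsub>V i\<^esub> e j\<close> is \<open>\<upsilon> i\<close> times the \<open>j\<close>-th
  coefficient of \<open>\<pi>\<^bsub>V i\<^esub> f\<close>. Hence, as \<open>T\<^sub>i\<close> is bounded and linear, summing the terms of the vector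
  expansion with first index \<open>i\<close> over \<open>j\<close> gives \<open>\<omega> i \<upsilon> i T\<^sub>i \<pi>\<^bsub>V i\<^esub> f\<close>, the \<open>i\<close>-th term of the fusion
  expansion (\<open>iterated_expansion\<close>). The two duality conditions therefore say that the same double
  series has sum \<open>K f\<close>, once as an iterated and once as an unordered sum over \<open>I \<times> J\<close>.
  
  An unordered double sum may be evaluated by rows. For the converse the double series has to be
  unconditionally convergent beforehand. It is: its coefficients are square summable because
  \<open>{\<upsilon> i \<pi>\<^bsub>V i\<^esub> e j}\<close> is a Bessel sequence, by the Bessel condition for \<open>V\<close>
  (\<open>bessel_sequence_basis_projections\<close>), its vectors \<open>\<omega> i T\<^sub>i e j\<close> form a Bessel sequence by the
  Bessel condition for \<open>W\<close> (\<open>frame_family_Bessel\<close>), and a square-summable combination of a Bessel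
  sequence converges unconditionally (\<open>Bessel_synthesis_summable\<close>). The first of these facts also
  gives the Bessel property that the vector condition demands of its dual.
  
  All this rests on \<open>(S\<^sub>W\<^sup>-\<^sup>1)\<^sup>*\<close> being a bounded operator (\<open>bounded_linear_on_frame_inv_adj\<close>), and this is
  where the closed range of \<open>K\<close> enters: by uniform boundedness \<open>K\<^sup>*\<close> is bounded below on \<open>R(K)\<close>
  (\<open>adjoint_bounded_below_on_closed_range\<close>), so the lower frame bound makes \<open>S\<^sub>W\<close> bounded below on
  \<open>R(K)\<close>. Then \<open>S\<^sub>W(R(K))\<close> is closed, the inverse of \<open>S\<^sub>W\<close> on it is bounded, and its adjoint exists by
  the Riesz representation theorem.
\<close>

section \<open>Scalars\<close>

lemma norm_conjugate: "norm (conjugate z) = norm (z :: 'k::hilbert_scalar)"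
proof (cases "z = 0")
  case False
  have "norm z * norm (conjugate z) = norm (z * conjugate z)"
    by (simp add: norm_mult)
  also have "\<dots> = norm z * norm z"
    by (simp add: mult_conjugate power2_eq_square)
  finally show ?thesis
    using False by simp
qed simp

lemma conjugate_of_real: "conjugate (of_real r) = (of_real r :: 'k::hilbert_scalar)"
proof (cases "r = 0")
  case False
  have "of_real r * conjugate (of_real r) = of_real r * (of_real r :: 'k)"
    using mult_conjugate[of "of_real r :: 'k"] by (simp add: power2_eq_square scaleR_conv_of_real)
  then show ?thesis
    using False by simp
qed simp

lemma mult_conjugate_of_real: "z * conjugate z = of_real ((norm (z :: 'k::hilbert_scalar))\<^sup>2)"
  by (simp only: mult_conjugate scaleR_conv_of_real mult_1_right)

section \<open>Unconditional convergence\<close>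

text \<open>
  The hypothesis turns the Cauchy condition for \<open>w\<close> into the one for \<open>u\<close>. It only looks at the norm
  of a finite sum, not at the sum of the norms, so it also covers series in infinite dimension that
  converge unconditionally but not absolutely, such as orthogonal expansions.
\<close>

lemma summable_on_if_norm_sum_le:
  fixes u :: "'n \<Rightarrow> 'a::banach" and w :: "'n \<Rightarrow> real"
  assumes w: "w summable_on N" "\<And>k. k \<in> N \<Longrightarrow> 0 \<le> w k"
    and le: "\<And>F. finite F \<Longrightarrow> F \<subseteq> N \<Longrightarrow> (norm (sum u F))\<^sup>2 \<le> C * sum w F"
  shows "u summable_on N"
proof -
  have small: "\<exists>F0. finite F0 \<and> F0 \<subseteq> N \<and>
      (\<forall>F. finite F \<and> F \<subseteq> N \<and> F \<inter> F0 = {} \<longrightarrow> norm (sum u F) < d)" if "d > 0" for d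
  proof -
    \<comment> \<open>Chosen so that \<open>\<bar>C\<bar> * \<delta>\<close> stays below \<open>d\<^sup>2\<close>, also if \<open>C\<close> is zero.\<close>
    define \<delta> where "\<delta> = d\<^sup>2 / (2 * (\<bar>C\<bar> + 1))"
    have "\<delta> > 0"
      using that by (simp add: \<delta>_def add_nonneg_pos)
    then obtain F0 where F0: "finite F0" "F0 \<subseteq> N" "dist (sum w F0) (infsum w N) \<le> \<delta>"
      using has_sum_finite_approximation[OF has_sum_infsum[OF w(1)]] by blast
    have "norm (sum u F) < d" if F: "finite F" "F \<subseteq> N" "F \<inter> F0 = {}" for F
    proof -
      have "sum w F0 + sum w F = sum w (F0 \<union> F)"
        using F F0 by (subst sum.union_disjoint) auto
      also have "\<dots> \<le> infsum w N"
        using F F0 w by (intro finite_sum_le_infsum) auto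
      finally have "sum w F \<le> \<delta>"
        using F0(3) by (simp add: dist_real_def)
      have "(norm (sum u F))\<^sup>2 \<le> C * sum w F"
        using F by (intro le)
      also have "\<dots> \<le> \<bar>C\<bar> * \<delta>"
        using \<open>sum w F \<le> \<delta>\<close> F w(2)
        by (intro mult_mono abs_ge_self sum_nonneg) auto
      also have "\<dots> < (\<bar>C\<bar> + 1) * \<delta> * 2"
        using \<open>\<delta> > 0\<close> by (simp add: algebra_simps add_nonneg_pos)
      also have "\<dots> = d\<^sup>2"
      proof -
        have "\<bar>C\<bar> + 1 \<noteq> 0" by arith
        then show ?thesis by (simp add: \<delta>_def field_simps)
      qed
      finally show ?thesis
        using \<open>d > 0\<close> by (simp add: power_less_imp_less_base)
    qed
    with F0 show ?thesis
      by blast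
  qed
  have "\<exists>P. eventually P (finite_subsets_at_top N) \<and>
      (\<forall>F1 F2. P F1 \<and> P F2 \<longrightarrow> dist (sum u F1) (sum u F2) < \<epsilon>)" if "\<epsilon> > 0" for \<epsilon> :: real
  proof -
    obtain F0 where F0: "finite F0" "F0 \<subseteq> N"
      and tail: "\<And>F. finite F \<Longrightarrow> F \<subseteq> N \<Longrightarrow> F \<inter> F0 = {} \<Longrightarrow> norm (sum u F) < \<epsilon> / 2"
      using small[OF half_gt_zero[OF \<open>\<epsilon> > 0\<close>]] by metis
    let ?P = "\<lambda>F. finite F \<and> F0 \<subseteq> F \<and> F \<subseteq> N"
    have near: "norm (sum u F - sum u F0) < \<epsilon> / 2" if "?P F" for F
      using that tail[of "F - F0"] F0 by (auto simp: sum_diff)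
    have "dist (sum u F1) (sum u F2) < \<epsilon>" if "?P F1" "?P F2" for F1 F2
      using near[OF that(1)] near[OF that(2)]
        dist_triangle_half_l[of "sum u F1" "sum u F0" \<epsilon> "sum u F2"]
      by (simp add: dist_norm)
    moreover have "eventually ?P (finite_subsets_at_top N)"
      unfolding eventually_finite_subsets_at_top using F0 by (intro exI[of _ F0]) simp
    ultimately show ?thesis
      by (intro exI[of _ ?P]) simp
  qed
  then have "cauchy_filter (filtermap (sum u) (finite_subsets_at_top N))"
    by (simp add: cauchy_filter_metric_filtermap)
  then obtain L where "filtermap (sum u) (finite_subsets_at_top N) \<le> nhds L"
    using complete_UNIV_cuspace[where 'a = 'a] unfolding complete_uniform
    by (metis filtermap_bot_iff finite_subsets_at_top_neq_bot principal_UNIV top_greatest UNIV_I)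
  then show ?thesis
    unfolding summable_on_def has_sum_def filterlim_def by blast
qed

lemma norm_has_sum_le:
  fixes u :: "'n \<Rightarrow> 'a::real_normed_vector"
  assumes "(u has_sum s) N" "\<And>F. finite F \<Longrightarrow> F \<subseteq> N \<Longrightarrow> norm (sum u F) \<le> D"
  shows "norm s \<le> D"
proof (rule tendsto_upperbound)
  show "((\<lambda>F. norm (sum u F)) \<longlongrightarrow> norm s) (finite_subsets_at_top N)"
    using assms(1) unfolding has_sum_def by (rule tendsto_norm)
  show "\<forall>\<^sub>F F in finite_subsets_at_top N. norm (sum u F) \<le> D"
    using assms(2) by (intro eventually_finite_subsets_at_top_weakI) auto
qed simp

section \<open>The inner product\<close>

context hilbert_space
begin

lemma ip_scaleR_left: "ip (r *\<^sub>R x) y = of_real r * ip x y"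
  by (metis scale_of_real ip_scale_left)

lemma ip_zero_left [simp]: "ip 0 y = 0"
  using ip_scaleR_left[of 0 0 y] by simp

lemma ip_minus_left: "ip (- x) y = - ip x y"
  using ip_scaleR_left[of "-1" x y] by simp

lemma ip_diff_left: "ip (x - z) y = ip x y - ip z y"
  using ip_add_left[of x "- z" y] by (simp add: ip_minus_left)

lemma ip_sum_left: "ip (sum f F) y = (\<Sum>k\<in>F. ip (f k) y)"
  by (induction F rule: infinite_finite_induct) (auto simp: ip_add_left)

lemma ip_add_right: "ip x (y + z) = ip x y + ip x z"
  by (metis ip_commute ip_add_left conjugate_dist_add)

lemma ip_scale_right: "ip x (smul c y) = conjugate c * ip x y"
  by (metis ip_commute ip_scale_left conjugate_dist_mul)

lemma ip_scaleR_right: "ip x (r *\<^sub>R y) = of_real r * ip x y"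
  by (metis scale_of_real ip_scale_right conjugate_of_real)

lemma ip_zero_right [simp]: "ip x 0 = 0"
  using ip_scaleR_right[of x 0 0] by simp

lemma ip_sum_right: "ip x (sum f F) = (\<Sum>k\<in>F. ip x (f k))"
  by (induction F rule: infinite_finite_induct) (auto simp: ip_add_right)

lemma ip_minus_right: "ip x (- y) = - ip x y"
  using ip_scaleR_right[of x "-1" y] by simp

lemma ip_diff_right: "ip x (y - z) = ip x y - ip x z"
  using ip_add_right[of x y "- z"] by (simp add: ip_minus_right)

lemma norm_ip_commute: "norm (ip x y) = norm (ip y x)"
  by (metis ip_commute norm_conjugate)

lemma ip_eq_0_commute: "ip x y = 0 \<longleftrightarrow> ip y x = 0"
  by (metis norm_eq_zero norm_ip_commute)

lemma norm_ip_self: "norm (ip x x) = (norm x)\<^sup>2"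
  by (simp add: ip_self norm_power del: of_real_power)

lemma norm_smul: "norm (smul c x) = norm c * norm x"
proof -
  have "(of_real ((norm (smul c x))\<^sup>2) :: 'k) = (c * conjugate c) * of_real ((norm x)\<^sup>2)"
    by (simp only: ip_self[symmetric] ip_scale_left ip_scale_right mult.assoc mult.left_commute)
  also have "\<dots> = of_real ((norm c * norm x)\<^sup>2)"
    by (simp add: mult_conjugate_of_real power_mult_distrib)
  finally have "(norm (smul c x))\<^sup>2 = (norm c * norm x)\<^sup>2"
    by (simp only: of_real_eq_iff)
  then show ?thesis
    by (simp add: power2_eq_iff_nonneg)
qed

lemma norm_add_square_orthogonal:
  assumes "ip x y = 0"
  shows "(norm (x + y))\<^sup>2 = (norm x)\<^sup>2 + (norm y)\<^sup>2"
proof -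
  have "ip (x + y) (x + y) = ip x x + ip y y"
    using assms ip_eq_0_commute[of x y] by (simp add: ip_add_left ip_add_right)
  then show ?thesis
    by (simp only: ip_self of_real_add[symmetric] of_real_eq_iff)
qed

lemma parallelogram:
  fixes x y :: 'a
  shows "(norm (x + y))\<^sup>2 + (norm (x - y))\<^sup>2 = 2 * (norm x)\<^sup>2 + 2 * (norm y)\<^sup>2"
proof -
  have "ip (x + y) (x + y) + ip (x - y) (x - y) = (ip x x + ip x x) + (ip y y + ip y y)"
    by (simp add: ip_add_left ip_add_right ip_diff_left ip_diff_right)
  then show ?thesis
    by (simp only: ip_self of_real_add[symmetric] of_real_eq_iff)
qed

text \<open>
  Subtracting from \<open>x\<close> its component along \<open>u\<close> shortens it by exactly that component. That the left
  side is nonnegative is the Cauchy-Schwarz inequality; that a vector of minimal length cannot be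
  shortened further gives the orthogonality in the projection theorem.
\<close>

lemma norm_diff_line_square:
  assumes "u \<noteq> 0"
  shows "(norm (x - smul (ip x u / of_real ((norm u)\<^sup>2)) u))\<^sup>2
    = (norm x)\<^sup>2 - (norm (ip x u))\<^sup>2 / (norm u)\<^sup>2"
proof -
  let ?p = "smul (ip x u / of_real ((norm u)\<^sup>2)) u"
  have "ip (x - ?p) u = 0"
    using assms by (simp add: ip_diff_left ip_scale_left ip_self)
  then have "ip (x - ?p) ?p = 0"
    by (simp add: ip_scale_right)
  from norm_add_square_orthogonal[OF this]
  have "(norm x)\<^sup>2 = (norm (x - ?p))\<^sup>2 + (norm ?p)\<^sup>2"
    by simp
  moreover have "(norm ?p)\<^sup>2 = (norm (ip x u))\<^sup>2 / (norm u)\<^sup>2"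
    using assms by (simp add: norm_smul norm_divide norm_power power_divide power_mult_distrib
        field_simps power2_eq_square del: of_real_mult)
  ultimately show ?thesis
    by simp
qed

lemma Cauchy_Schwarz: "norm (ip x y) \<le> norm x * norm y"
proof (cases "y = 0")
  case False
  have "0 \<le> (norm x)\<^sup>2 - (norm (ip x y))\<^sup>2 / (norm y)\<^sup>2"
    by (simp only: norm_diff_line_square[OF False, symmetric] zero_le_power2)
  then have "(norm (ip x y))\<^sup>2 \<le> (norm x * norm y)\<^sup>2"
    using False by (simp add: field_simps)
  then show ?thesis
    by (rule power2_le_imp_le) simp
qed simp

lemma bounded_linear_ip_left: "bounded_linear (\<lambda>x. ip x y)"
  by (rule bounded_linear_intro[of _ "norm y"])
    (auto simp: ip_add_left ip_scaleR_left scaleR_conv_of_real Cauchy_Schwarz)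

lemma continuous_ip_left [continuous_intros]: "continuous_on S (\<lambda>x. ip x y)"
  by (rule linear_continuous_on[OF bounded_linear_ip_left])

section \<open>Orthogonal projections\<close>

lemma closed_subspace_UNIV: "closed_subspace smul UNIV"
  by (simp add: closed_subspace_def)

text \<open>
  The projection theorem. By the parallelogram law the midpoint of two nearly optimal points of \<open>U\<close>
  would be better than both if they were far apart, so a minimizing sequence is Cauchy; its limit is
  a nearest point of \<open>U\<close>, and moving it along any \<open>v \<in> U\<close> cannot decrease the distance.
\<close>

lemma proj_exists:
  assumes U: "closed_subspace smul U"
  shows "\<exists>p\<in>U. \<forall>u\<in>U. ip (x - p) u = 0"
proof -
  have sub: "subspace U" and clo: "closed U"
    using U by (auto simp: closed_subspace_def)
  define d where "d = (INF u\<in>U. (norm (x - u))\<^sup>2)"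
  have bdd: "bdd_below ((\<lambda>u. (norm (x - u))\<^sup>2) ` U)"
    by (rule bdd_belowI[of _ 0]) auto
  have ne: "U \<noteq> {}"
    using subspace_0[OF sub] by blast
  have d_le: "d \<le> (norm (x - u))\<^sup>2" if "u \<in> U" for u
    unfolding d_def using bdd that by (rule cINF_lower)
  have "\<exists>u\<in>U. (norm (x - u))\<^sup>2 < d + 1 / real (Suc n)" for n
    using cINF_less_iff[OF ne bdd, of "d + 1 / real (Suc n)"] by (simp add: d_def)
  then obtain u where u: "\<And>n. u n \<in> U" "\<And>n. (norm (x - u n))\<^sup>2 < d + 1 / real (Suc n)"
    by metis
  have dist_u: "(norm (u m - u n))\<^sup>2 \<le> 2 / real (Suc m) + 2 / real (Suc n)" for m n
  proof -
    let ?c = "(1 / 2) *\<^sub>R (u m + u n)"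
    have "?c \<in> U"
      using u(1) sub by (simp only: scale_of_real[symmetric] subspace_add subspace_scale)
    then have "4 * d \<le> 4 * (norm (x - ?c))\<^sup>2"
      using d_le by simp
    also have "\<dots> = (norm (2 *\<^sub>R (x - ?c)))\<^sup>2"
      by (simp only: norm_scaleR power_mult_distrib) simp
    also have "2 *\<^sub>R (x - ?c) = (x - u m) + (x - u n)"
      by (simp add: algebra_simps scaleR_2)
    finally have "4 * d \<le> (norm ((x - u m) + (x - u n)))\<^sup>2" .
    moreover have "(x - u m) - (x - u n) = u n - u m"
      by simp
    ultimately show ?thesis
      using parallelogram[of "x - u m" "x - u n"] u(2)[of m] u(2)[of n]
      by (simp add: norm_minus_commute)
  qed
  have "Cauchy u"
  proof (rule metric_CauchyI)
    fix \<epsilon> :: real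
    assume "\<epsilon> > 0"
    then obtain N where N: "4 / \<epsilon>\<^sup>2 < real N"
      using reals_Archimedean2 by blast
    have "dist (u m) (u n) < \<epsilon>" if "m \<ge> N" "n \<ge> N" for m n
    proof -
      have "real N > 0"
        using N \<open>\<epsilon> > 0\<close> by (meson divide_pos_pos less_trans zero_less_numeral zero_less_power)
      have "2 / real (Suc k) \<le> 2 / real N" if "k \<ge> N" for k
        using that \<open>real N > 0\<close> by (intro divide_left_mono) auto
      then have "(norm (u m - u n))\<^sup>2 \<le> 4 / real N"
        using dist_u[of m n] that by (smt (verit) add_divide_distrib)
      also have "\<dots> < \<epsilon>\<^sup>2"
        using N \<open>\<epsilon> > 0\<close> \<open>real N > 0\<close> by (simp add: field_simps)
      finally show ?thesis
        using \<open>\<epsilon> > 0\<close> by (simp add: dist_norm power_less_imp_less_base)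
    qed
    then show "\<exists>N. \<forall>m\<ge>N. \<forall>n\<ge>N. dist (u m) (u n) < \<epsilon>"
      by blast
  qed
  then obtain p where p: "u \<longlonglongrightarrow> p"
    using Cauchy_convergent convergent_def by blast
  have "p \<in> U"
    using clo u(1) p by (rule closed_sequentially)
  have "(norm (x - p))\<^sup>2 \<le> d"
  proof (rule LIMSEQ_le)
    show "(\<lambda>n. (norm (x - u n))\<^sup>2) \<longlonglongrightarrow> (norm (x - p))\<^sup>2"
      using p by (intro tendsto_intros)
    show "(\<lambda>n. d + 1 / real (Suc n)) \<longlonglongrightarrow> d"
      using tendsto_add[OF tendsto_const LIMSEQ_inverse_real_of_nat, of d]
      by (simp add: inverse_eq_divide)
    show "\<exists>N. \<forall>n\<ge>N. (norm (x - u n))\<^sup>2 \<le> d + 1 / real (Suc n)"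
      using u(2) less_imp_le by blast
  qed
  have "ip (x - p) v = 0" if "v \<in> U" for v
  proof (cases "v = 0")
    case False
    let ?t = "ip (x - p) v / of_real ((norm v)\<^sup>2)"
    have "p + smul ?t v \<in> U"
      using \<open>p \<in> U\<close> that sub by (intro subspace_add subspace_scale)
    then have "d \<le> (norm ((x - p) - smul ?t v))\<^sup>2"
      using d_le by (simp add: diff_diff_eq)
    also have "\<dots> = (norm (x - p))\<^sup>2 - (norm (ip (x - p) v))\<^sup>2 / (norm v)\<^sup>2"
      using False by (rule norm_diff_line_square)
    finally have "(norm (ip (x - p) v))\<^sup>2 / (norm v)\<^sup>2 \<le> 0"
      using \<open>(norm (x - p))\<^sup>2 \<le> d\<close> by linarith
    then show ?thesis
      using False by (simp add: divide_le_0_iff)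
  qed simp
  with \<open>p \<in> U\<close> show ?thesis
    by blast
qed

lemma proj_eqI:
  assumes "closed_subspace smul U" "p \<in> U" "\<And>u. u \<in> U \<Longrightarrow> ip (x - p) u = 0"
  shows "proj ip U x = p"
  unfolding proj_def
proof (rule the_equality)
  fix q
  assume q: "q \<in> U \<and> (\<forall>u\<in>U. ip (x - q) u = 0)"
  have "q - p \<in> U"
    using assms q by (auto simp: closed_subspace_def subspace_diff)
  then have "ip (x - p) (q - p) - ip (x - q) (q - p) = 0"
    using assms q by simp
  then have "ip (q - p) (q - p) = 0"
    by (simp add: ip_diff_left[symmetric])
  then show "q = p"
    using norm_ip_self[of "q - p"] by simp
qed (use assms in auto)

lemma
  assumes "closed_subspace smul U"
  shows proj_mem: "proj ip U x \<in> U"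
    and proj_orthogonal: "u \<in> U \<Longrightarrow> ip (x - proj ip U x) u = 0"
proof -
  obtain p where "p \<in> U" "\<forall>u\<in>U. ip (x - p) u = 0"
    using proj_exists[OF assms, of x] by blast
  then show "proj ip U x \<in> U" "u \<in> U \<Longrightarrow> ip (x - proj ip U x) u = 0"
    using proj_eqI[OF assms, of p x] by auto
qed

lemma proj_ip_left:
  assumes "closed_subspace smul U" "u \<in> U"
  shows "ip (proj ip U x) u = ip x u"
  using proj_orthogonal[OF assms, of x] by (simp add: ip_diff_left)

lemma proj_ip_right:
  assumes "closed_subspace smul U" "u \<in> U"
  shows "ip u (proj ip U x) = ip u x"
  using proj_ip_left[OF assms, of x] by (metis ip_commute)

lemma proj_self_adjoint:
  assumes "closed_subspace smul U"
  shows "ip (proj ip U x) y = ip x (proj ip U y)"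
  using proj_ip_left[OF assms proj_mem[OF assms], of x y]
    proj_ip_right[OF assms proj_mem[OF assms], of x y] by simp

section \<open>Bounded linear maps on subspaces\<close>

text \<open>
  The inverse of the frame operator is linear only on a subspace and has arbitrary values elsewhere,
  so operators come with the domain on which they are linear over \<open>'k\<close> and bounded.
\<close>

definition bounded_linear_on :: "'a set \<Rightarrow> ('a \<Rightarrow> 'a) \<Rightarrow> real \<Rightarrow> bool" where
  "bounded_linear_on M T C \<longleftrightarrow> 0 \<le> C \<and>
     (\<forall>x\<in>M. \<forall>y\<in>M. T (x + y) = T x + T y) \<and>
     (\<forall>c. \<forall>x\<in>M. T (smul c x) = smul c (T x)) \<and>
     (\<forall>x\<in>M. norm (T x) \<le> C * norm x)"

lemma bounded_linear_on_subset:
  "bounded_linear_on M T C \<Longrightarrow> N \<subseteq> M \<Longrightarrow> bounded_linear_on N T C"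
  unfolding bounded_linear_on_def by blast

lemma bounded_linear_on_bounded_linear:
  assumes "bounded_linear_on UNIV T C"
  shows "bounded_linear T"
proof (rule bounded_linear_intro[of _ C])
  show "T (r *\<^sub>R x) = r *\<^sub>R T x" for r x
    using assms by (metis bounded_linear_on_def UNIV_I scale_of_real)
qed (use assms in \<open>auto simp: bounded_linear_on_def mult.commute\<close>)

lemma bounded_linear_on_proj:
  assumes U: "closed_subspace smul U"
  shows "bounded_linear_on UNIV (proj ip U) 1"
proof -
  have sub: "subspace U"
    using U by (simp add: closed_subspace_def)
  have "proj ip U (x + y) = proj ip U x + proj ip U y" for x y
    using U sub by (intro proj_eqI subspace_add proj_mem)
      (auto simp: ip_add_left ip_diff_left proj_ip_left)
  moreover have "proj ip U (smul c x) = smul c (proj ip U x)" for c x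
    using U sub by (intro proj_eqI subspace_scale proj_mem)
      (auto simp: ip_scale_left ip_diff_left proj_ip_left)
  moreover have "norm (proj ip U x) \<le> norm x" for x
  proof -
    have "norm (proj ip U x) * norm (proj ip U x) = norm (ip x (proj ip U x))"
      using norm_ip_self[of "proj ip U x"] U
      by (simp add: proj_ip_left proj_mem power2_eq_square)
    also have "\<dots> \<le> norm x * norm (proj ip U x)"
      by (rule Cauchy_Schwarz)
    finally show ?thesis
      by (cases "proj ip U x = 0") auto
  qed
  ultimately show ?thesis
    by (simp add: bounded_linear_on_def)
qed

lemma bounded_linear_on_comp:
  assumes "bounded_linear_on UNIV S C" "bounded_linear_on UNIV T D"
  shows "bounded_linear_on UNIV (\<lambda>x. S (T x)) (C * D)"
proof -
  have "norm (S (T x)) \<le> C * D * norm x" for x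
  proof -
    have "norm (S (T x)) \<le> C * norm (T x)"
      using assms by (simp add: bounded_linear_on_def)
    also have "\<dots> \<le> C * (D * norm x)"
      using assms by (simp add: bounded_linear_on_def mult_left_mono)
    finally show ?thesis by simp
  qed
  then show ?thesis
    using assms by (auto simp: bounded_linear_on_def)
qed

lemma bounded_operator_bounded_linear_on:
  assumes "bounded_operator smul T"
  obtains C where "bounded_linear_on UNIV T C"
proof -
  obtain C where C: "\<And>x. norm (T x) \<le> C * norm x" and lin: "Vector_Spaces.linear smul smul T"
    using assms by (auto simp: bounded_operator_def)
  interpret T: Vector_Spaces.linear smul smul T
    by (rule lin)
  have "norm (T x) \<le> \<bar>C\<bar> * norm x" for x
    using C[of x] by (meson abs_ge_self mult_right_mono norm_ge_zero order_trans)
  then have "bounded_linear_on UNIV T \<bar>C\<bar>"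
    by (simp add: bounded_linear_on_def T.add T.scale)
  then show thesis
    by (rule that)
qed

lemma subspace_image:
  assumes "subspace M" "bounded_linear_on M T C"
  shows "subspace (T ` M)"
proof (rule subspaceI)
  have "T (smul 0 0) = smul 0 (T 0)"
    using assms subspace_0 unfolding bounded_linear_on_def by blast
  then show "0 \<in> T ` M"
    using subspace_0[OF assms(1)] by force
next
  fix x y
  assume "x \<in> T ` M" "y \<in> T ` M"
  then show "x + y \<in> T ` M"
    using assms subspace_add[OF assms(1)] unfolding bounded_linear_on_def
    by (metis (no_types, lifting) imageE imageI)
next
  fix c x
  assume "x \<in> T ` M"
  then show "smul c x \<in> T ` M"
    using assms subspace_scale[OF assms(1)] unfolding bounded_linear_on_def
    by (metis (no_types, lifting) imageE imageI)
qed

section \<open>Adjoints\<close>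

text \<open>
  If \<open>\<phi>\<close> is not zero, take \<open>q \<in> M\<close> orthogonal to its kernel \<open>N\<close> with \<open>\<phi> q \<noteq> 0\<close>. For every \<open>x \<in> M\<close> the
  vector \<open>\<phi> q \<cdot> x - \<phi> x \<cdot> q\<close> lies in \<open>N\<close>, and pairing it with \<open>q\<close> solves for \<open>\<phi> x\<close>.
\<close>

lemma Riesz_representation:
  assumes M: "closed_subspace smul M"
    and add: "\<And>x y. x \<in> M \<Longrightarrow> y \<in> M \<Longrightarrow> \<phi> (x + y) = \<phi> x + \<phi> y"
    and scale: "\<And>c x. x \<in> M \<Longrightarrow> \<phi> (smul c x) = c * \<phi> x"
    and bound: "\<And>x. x \<in> M \<Longrightarrow> norm (\<phi> x) \<le> C * norm x"
  shows "\<exists>z\<in>M. \<forall>x\<in>M. \<phi> x = ip x z"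
proof (cases "\<forall>x\<in>M. \<phi> x = 0")
  case True
  then show ?thesis
    using M subspace_0 by (intro bexI[of _ 0]) (auto simp: closed_subspace_def)
next
  case False
  then obtain y where y: "y \<in> M" "\<phi> y \<noteq> 0"
    by blast
  have sub: "subspace M" and clo: "closed M"
    using M by (auto simp: closed_subspace_def)
  have diff: "\<phi> (a - b) = \<phi> a - \<phi> b" if "a \<in> M" "b \<in> M" for a b
  proof -
    have "\<phi> ((a - b) + b) = \<phi> (a - b) + \<phi> b"
      using that sub by (intro add subspace_diff)
    then show ?thesis
      by simp
  qed
  define N where "N = {x \<in> M. \<phi> x = 0}"
  have N: "closed_subspace smul N"
    unfolding closed_subspace_def
  proof
    have "\<phi> 0 = 0"
      using diff[of 0 0] subspace_0[OF sub] by simp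
    then show "subspace N"
      using sub by (intro subspaceI) (auto simp: N_def add scale subspace_0 subspace_add subspace_scale)
    show "closed N"
      unfolding closed_sequential_limits
    proof (intro allI impI)
      fix x l
      assume x: "(\<forall>n. x n \<in> N) \<and> x \<longlonglongrightarrow> l"
      then have "l \<in> M"
        using clo by (auto simp: N_def intro: closed_sequentially)
      have "norm (\<phi> l) \<le> C * norm (l - x n)" for n
        using bound[of "l - x n"] diff[of l "x n"] x \<open>l \<in> M\<close> sub by (auto simp: N_def subspace_diff)
      moreover have "(\<lambda>n. C * norm (l - x n)) \<longlonglongrightarrow> C * norm (l - l)"
        using x by (intro tendsto_intros) auto
      ultimately have "norm (\<phi> l) \<le> C * norm (l - l)"
        by (intro tendsto_lowerbound[of _ _ sequentially]) auto
      then show "l \<in> N"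
        using \<open>l \<in> M\<close> by (simp add: N_def)
    qed
  qed
  define q where "q = y - proj ip N y"
  have pN: "proj ip N y \<in> N"
    by (rule proj_mem[OF N])
  have "q \<in> M" "\<phi> q = \<phi> y"
    using pN y sub by (auto simp: q_def N_def diff subspace_diff)
  then have "\<phi> q \<noteq> 0"
    using y by simp
  then have "q \<noteq> 0"
    using diff[of 0 0] subspace_0[OF sub] by auto
  define t where "t = \<phi> q / of_real ((norm q)\<^sup>2)"
  have "\<phi> x = ip x (smul (conjugate t) q)" if "x \<in> M" for x
  proof -
    have "smul (\<phi> q) x - smul (\<phi> x) q \<in> N"
      using that \<open>q \<in> M\<close> sub
      by (simp add: N_def diff scale subspace_diff subspace_scale mult.commute)
    then have "ip (smul (\<phi> q) x - smul (\<phi> x) q) q = 0"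
      using proj_orthogonal[OF N, of _ y] ip_eq_0_commute by (simp add: q_def)
    then have "\<phi> q * ip x q = \<phi> x * of_real ((norm q)\<^sup>2)"
      by (simp add: ip_diff_left ip_scale_left ip_self)
    then show ?thesis
      using \<open>q \<noteq> 0\<close> by (simp add: t_def ip_scale_right field_simps)
  qed
  moreover have "smul (conjugate t) q \<in> M"
    using sub \<open>q \<in> M\<close> by (rule subspace_scale)
  ultimately show ?thesis
    by blast
qed

lemma adj_on_eqI:
  assumes M: "closed_subspace smul M" and z: "z \<in> M" "\<And>x. x \<in> M \<Longrightarrow> ip (T x) y = ip x z"
  shows "adj_on ip M T y = z"
  unfolding adj_on_def
proof (rule the_equality)
  fix w
  assume w: "w \<in> M \<and> (\<forall>x\<in>M. ip (T x) y = ip x w)"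
  then have "w - z \<in> M"
    using M z by (auto simp: closed_subspace_def subspace_diff)
  then have "ip (w - z) w = ip (w - z) z"
    using w z by metis
  then have "ip (w - z) (w - z) = 0"
    by (simp add: ip_diff_right)
  then show "w = z"
    using norm_ip_self[of "w - z"] by simp
qed (use z in auto)

lemma
  assumes M: "closed_subspace smul M" and T: "bounded_linear_on M T C"
  shows adj_on_mem: "adj_on ip M T y \<in> M"
    and ip_adj_on: "x \<in> M \<Longrightarrow> ip (T x) y = ip x (adj_on ip M T y)"
proof -
  have "norm (ip (T x) y) \<le> (C * norm y) * norm x" if "x \<in> M" for x
  proof -
    have "norm (ip (T x) y) \<le> norm (T x) * norm y"
      by (rule Cauchy_Schwarz)
    also have "\<dots> \<le> (C * norm x) * norm y"
      using T that by (intro mult_right_mono) (auto simp: bounded_linear_on_def)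
    finally show ?thesis
      by (simp add: mult_ac)
  qed
  then have "\<exists>z\<in>M. \<forall>x\<in>M. ip (T x) y = ip x z"
    using T by (intro Riesz_representation[OF M, of _ "C * norm y"])
      (auto simp: bounded_linear_on_def ip_add_left ip_scale_left)
  then obtain z where "z \<in> M" "\<forall>x\<in>M. ip (T x) y = ip x z"
    by blast
  then show "adj_on ip M T y \<in> M" "x \<in> M \<Longrightarrow> ip (T x) y = ip x (adj_on ip M T y)"
    using adj_on_eqI[OF M, of z T y] by auto
qed

lemma bounded_linear_on_adj_on:
  assumes M: "closed_subspace smul M" and T: "bounded_linear_on M T C"
  shows "bounded_linear_on UNIV (adj_on ip M T) C"
proof -
  have sub: "subspace M"
    using M by (simp add: closed_subspace_def)
  note mem = adj_on_mem[OF M T] and ip = ip_adj_on[OF M T]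
  have "adj_on ip M T (x + y) = adj_on ip M T x + adj_on ip M T y" for x y
    using mem ip sub by (intro adj_on_eqI[OF M]) (auto simp: ip_add_right subspace_add)
  moreover have "adj_on ip M T (smul c x) = smul c (adj_on ip M T x)" for c x
    using mem ip sub by (intro adj_on_eqI[OF M]) (auto simp: ip_scale_right subspace_scale)
  moreover have "norm (adj_on ip M T x) \<le> C * norm x" for x
  proof (cases "adj_on ip M T x = 0")
    case True
    then show ?thesis
      using T by (simp add: bounded_linear_on_def)
  next
    case False
    let ?z = "adj_on ip M T x"
    have "norm ?z * norm ?z = norm (ip (T ?z) x)"
      using ip[OF mem, of x x] by (simp add: norm_ip_self power2_eq_square)
    also have "\<dots> \<le> norm (T ?z) * norm x"
      by (rule Cauchy_Schwarz)
    also have "\<dots> \<le> (C * norm ?z) * norm x"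
      using T mem[of x] by (intro mult_right_mono) (auto simp: bounded_linear_on_def)
    finally show ?thesis
      using False by (simp add: mult_ac)
  qed
  ultimately show ?thesis
    using T by (simp add: bounded_linear_on_def)
qed

section \<open>Operators bounded below\<close>

text \<open>
  The uniform boundedness principle for the functionals \<open>ip _ f\<close>. By Baire, one of the closed sets on
  which all of them are bounded by \<open>n\<close> contains a ball, and moving from its centre to its
  boundary in the direction of \<open>f\<close> changes the value of the functional by the radius times \<open>\<parallel>f\<parallel>\<close>.
\<close>

lemma uniform_boundedness:
  assumes "\<And>x. \<exists>c. \<forall>f\<in>F. norm (ip x f) \<le> c"
  shows "\<exists>C. \<forall>f\<in>F. norm f \<le> C"
proof -
  define E where "E n = {x. \<forall>f\<in>F. norm (ip x f) \<le> real n}" for n :: nat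
  have "closed (E n)" for n
  proof -
    have "E n = (\<Inter>f\<in>F. {x. norm (ip x f) \<le> real n})"
      by (auto simp: E_def)
    also have "closed \<dots>"
      by (intro closed_INT ballI closed_Collect_le continuous_intros)
    finally show ?thesis .
  qed
  moreover have "\<exists>n. x \<in> E n" for x
  proof -
    obtain c where c: "\<forall>f\<in>F. norm (ip x f) \<le> c"
      using assms by blast
    obtain n where "c \<le> real n"
      using real_arch_simple by blast
    with c show ?thesis
      by (auto simp: E_def intro: order_trans)
  qed
  then have "\<Union>(range E) = UNIV"
    by auto
  ultimately have "\<exists>n. interior (E n) \<noteq> {}"
    using Met_TC.metric_Baire_category_alt[of "range E"] complete_UNIV_cuspace[where 'a = 'a]
    by auto
  then obtain n x0 where "x0 \<in> interior (E n)"
    by blast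
  then obtain r where r: "r > 0" "cball x0 r \<subseteq> E n"
    unfolding mem_interior_cball by blast
  have "norm f \<le> 2 * real n / r" if f: "f \<in> F" for f
  proof (cases "f = 0")
    case False
    let ?y = "x0 + (r / norm f) *\<^sub>R f"
    have "?y \<in> E n" "x0 \<in> E n"
      using r False by (auto simp: dist_norm)
    then have "norm (ip ?y f - ip x0 f) \<le> real n + real n"
      using f by (intro norm_triangle_le_diff add_mono) (auto simp: E_def)
    also have "ip ?y f - ip x0 f = of_real (r / norm f * (norm f)\<^sup>2)"
      by (simp only: ip_add_left ip_scaleR_left ip_self of_real_mult) simp
    also have "r / norm f * (norm f)\<^sup>2 = r * norm f"
      using False by (simp add: power2_eq_square)
    finally show ?thesis
      using r(1) by (simp add: field_simps norm_mult)
  qed (use r in auto)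
  then show ?thesis
    by blast
qed

text \<open>
  The part of the closed range theorem that is used. For \<open>f \<in> R(K)\<close> with \<open>\<parallel>K\<^sup>* f\<parallel> \<le> 1\<close>, the projection of
  any \<open>x\<close> to \<open>R(K)\<close> is some \<open>K g\<close>, and \<open>\<langle>x, f\<rangle> = \<langle>K g, f\<rangle> = \<langle>g, K\<^sup>* f\<rangle>\<close> is bounded by \<open>\<parallel>g\<parallel>\<close>. So these \<open>f\<close> are
  pointwise bounded, hence bounded in norm.
\<close>

lemma adjoint_bounded_below_on_closed_range:
  assumes K: "bounded_linear_on UNIV K C0" and clo: "closed (range K)"
  shows "\<exists>C>0. \<forall>f\<in>range K. norm f \<le> C * norm (adj_on ip UNIV K f)"
proof -
  let ?K' = "adj_on ip UNIV K"
  have R: "closed_subspace smul (range K)"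
    using subspace_image[OF subspace_UNIV K] clo by (simp add: closed_subspace_def)
  note ipK = ip_adj_on[OF closed_subspace_UNIV K UNIV_I]
  interpret K': bounded_linear ?K'
    by (rule bounded_linear_on_bounded_linear[OF bounded_linear_on_adj_on[OF closed_subspace_UNIV K]])
  \<comment> \<open>The unit ball of the norm that \<open>K\<^sup>*\<close> induces on \<open>R(K)\<close>.\<close>
  define F where "F = {f \<in> range K. norm (?K' f) \<le> 1}"
  have "\<exists>c. \<forall>f\<in>F. norm (ip x f) \<le> c" for x
  proof -
    obtain g where g: "proj ip (range K) x = K g"
      using proj_mem[OF R, of x] by blast
    have "norm (ip x f) \<le> norm g" if f: "f \<in> F" for f
    proof -
      have "ip x f = ip g (?K' f)"
        using proj_ip_left[OF R, of f x] f by (simp add: g ipK F_def)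
      also have "norm \<dots> \<le> norm g * norm (?K' f)"
        by (rule Cauchy_Schwarz)
      also have "\<dots> \<le> norm g * 1"
        using f by (intro mult_left_mono) (auto simp: F_def)
      finally show ?thesis
        by simp
    qed
    then show ?thesis
      by blast
  qed
  then obtain C where C: "\<And>f. f \<in> F \<Longrightarrow> norm f \<le> C"
    using uniform_boundedness[of F] by blast
  have "norm f \<le> max C 1 * norm (?K' f)" if f: "f \<in> range K" for f
  proof (cases "?K' f = 0")
    case True
    obtain g where "f = K g"
      using f by blast
    then have "ip f f = 0"
      using ipK[of g f] True by simp
    then show ?thesis
      using norm_ip_self[of f] by simp
  next
    case False
    let ?t = "inverse (norm (?K' f))"
    have "?t *\<^sub>R f \<in> range K"
      using R f unfolding closed_subspace_def by (metis scale_of_real subspace_scale)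
    then have "?t *\<^sub>R f \<in> F"
      using False by (simp add: F_def K'.scaleR)
    from C[OF this] have "norm f \<le> C * norm (?K' f)"
      using False by (simp add: field_simps)
    also have "\<dots> \<le> max C 1 * norm (?K' f)"
      by (intro mult_right_mono) auto
    finally show ?thesis .
  qed
  \<comment> \<open>The maximum makes the constant positive even if \<open>F\<close> is trivial.\<close>
  then show ?thesis
    by (intro exI[of _ "max C 1"]) auto
qed

text \<open>
  A bound from below makes preimages of Cauchy sequences Cauchy; hence the image is complete and the
  inverse is bounded by the same constant.
\<close>

lemma
  assumes M: "closed_subspace smul M" and T: "bounded_linear_on UNIV T C"
    and c: "c > 0" and below: "\<And>x. x \<in> M \<Longrightarrow> norm x \<le> c * norm (T x)"
  shows closed_subspace_image: "closed_subspace smul (T ` M)"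
    and bounded_linear_on_inv_into: "bounded_linear_on (T ` M) (inv_into M T) c"
proof -
  have sub: "subspace M"
    using M by (simp add: closed_subspace_def)
  have TM: "bounded_linear_on M T C"
    using T by (rule bounded_linear_on_subset) simp
  interpret T: bounded_linear T
    by (rule bounded_linear_on_bounded_linear[OF T])
  have "Real_Vector_Spaces.subspace M"
    using sub by (simp add: Real_Vector_Spaces.subspace_def subspace_0 subspace_add
        scale_of_real[symmetric] subspace_scale)
  then have "complete (T ` M)"
    using M below c unfolding closed_subspace_def
    by (intro complete_isometric_image[of "inverse c"] T.bounded_linear_axioms)
      (auto simp: field_simps complete_eq_closed)
  then show "closed_subspace smul (T ` M)"
    using subspace_image[OF sub TM] by (simp add: closed_subspace_def complete_eq_closed)
  have inj: "inj_on T M"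
  proof (rule inj_onI)
    fix x y
    assume "x \<in> M" "y \<in> M" "T x = T y"
    then show "x = y"
      using below[of "x - y"] subspace_diff[OF sub] by (simp add: T.diff)
  qed
  have "inv_into M T (T x + T y) = x + y" if "x \<in> M" "y \<in> M" for x y
    using that inj by (intro inv_into_f_eq) (auto simp: T.add subspace_add[OF sub])
  moreover have "inv_into M T (smul a (T x)) = smul a x" if "x \<in> M" for a x
    using that inj T by (intro inv_into_f_eq)
      (auto simp: bounded_linear_on_def subspace_scale[OF sub])
  ultimately show "bounded_linear_on (T ` M) (inv_into M T) c"
    using c below inj by (auto simp: bounded_linear_on_def)
qed

section \<open>Square-summable synthesis\<close>

text \<open>
  The duality argument behind the boundedness of synthesis operators: pairing \<open>v = \<Sum>\<^bsub>k\<in>F\<^esub> u k\<close> with itself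
  and applying Cauchy-Schwarz to the sum of \<open>a k * b k v\<close> gives \<open>\<parallel>v\<parallel>\<^sup>4 \<le> \<Sum>(a k)\<^sup>2 \<cdot> C \<cdot> \<parallel>v\<parallel>\<^sup>2\<close>. It is
  stated with a bound on the pairings so that it serves both for \<open>u k = c k \<cdot> h k\<close> with a Bessel
  sequence \<open>h\<close> and for the series of the frame operator.
\<close>

lemma
  assumes a: "(\<lambda>k. (a k)\<^sup>2) summable_on N"
    and dom: "\<And>k v. k \<in> N \<Longrightarrow> norm (ip (u k) v) \<le> a k * b k v"
    and C: "0 \<le> C" and bessel: "\<And>F v. finite F \<Longrightarrow> F \<subseteq> N \<Longrightarrow> (\<Sum>k\<in>F. (b k v)\<^sup>2) \<le> C * (norm v)\<^sup>2"
  shows Bessel_synthesis_bound: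
      "finite F \<Longrightarrow> F \<subseteq> N \<Longrightarrow> (norm (sum u F))\<^sup>2 \<le> C * (\<Sum>k\<in>F. (a k)\<^sup>2)"
    and Bessel_synthesis_summable: "u summable_on N"
proof -
  show bound: "(norm (sum u F))\<^sup>2 \<le> C * (\<Sum>k\<in>F. (a k)\<^sup>2)" if F: "finite F" "F \<subseteq> N" for F
  proof (cases "sum u F = 0")
    case True
    then show ?thesis
      using C by (simp add: sum_nonneg)
  next
    case False
    let ?v = "sum u F"
    have "(norm ?v)\<^sup>2 = norm (\<Sum>k\<in>F. ip (u k) ?v)"
      by (simp only: norm_ip_self[symmetric] ip_sum_left)
    also have "\<dots> \<le> (\<Sum>k\<in>F. norm (ip (u k) ?v))"
      by (rule norm_sum)
    also have "\<dots> \<le> (\<Sum>k\<in>F. a k * b k ?v)"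
      using F by (intro sum_mono dom) auto
    finally have "((norm ?v)\<^sup>2)\<^sup>2 \<le> (\<Sum>k\<in>F. a k * b k ?v)\<^sup>2"
      by (intro power_mono) auto
    also have "\<dots> \<le> (\<Sum>k\<in>F. (a k)\<^sup>2) * (\<Sum>k\<in>F. (b k ?v)\<^sup>2)"
      by (rule Cauchy_Schwarz_ineq_sum)
    also have "\<dots> \<le> (\<Sum>k\<in>F. (a k)\<^sup>2) * (C * (norm ?v)\<^sup>2)"
      using bessel[OF F] by (intro mult_left_mono sum_nonneg) auto
    finally show ?thesis
      using False by (simp add: power2_eq_square mult_ac)
  qed
  show "u summable_on N"
    using a bound by (intro summable_on_if_norm_sum_le[of "\<lambda>k. (a k)\<^sup>2" N u C]) auto
qed

section \<open>Orthonormal expansions\<close>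

context
  fixes J :: "'j set" and e :: "'j \<Rightarrow> 'a"
  assumes onb: "orthonormal_basis smul ip J e"
begin

definition partial_expansion :: "'j set \<Rightarrow> 'a \<Rightarrow> 'a" where
  "partial_expansion F x = (\<Sum>j\<in>F. smul (ip x (e j)) (e j))"

lemma ip_basis: "j \<in> J \<Longrightarrow> k \<in> J \<Longrightarrow> ip (e j) (e k) = (if j = k then 1 else 0)"
  using onb by (simp add: orthonormal_basis_def)

lemma ip_partial_expansion:
  assumes "finite F" "F \<subseteq> J" "k \<in> J"
  shows "ip (partial_expansion F x) (e k) = (if k \<in> F then ip x (e k) else 0)"
proof -
  have "ip (partial_expansion F x) (e k) = (\<Sum>j\<in>F. if j = k then ip x (e k) else 0)"
    unfolding partial_expansion_def ip_sum_left
    using assms by (intro sum.cong) (auto simp: ip_scale_left ip_basis)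
  then show ?thesis
    using assms(1) by simp
qed

lemma
  assumes F: "finite F" "F \<subseteq> J"
  shows Bessel_inequality: "(\<Sum>j\<in>F. (norm (ip x (e j)))\<^sup>2) \<le> (norm x)\<^sup>2"
    and norm_partial_expansion_le: "norm (partial_expansion F x) \<le> norm x"
proof -
  let ?P = "partial_expansion F x"
  have "ip (x - ?P) (smul c (e j)) = 0" if "j \<in> F" for c j
    using that F ip_partial_expansion[OF F, of j x] by (auto simp: ip_scale_right ip_diff_left)
  then have "ip (x - ?P) ?P = 0"
    by (subst (2) partial_expansion_def) (simp add: ip_sum_right)
  from norm_add_square_orthogonal[OF this]
  have le: "(norm ?P)\<^sup>2 \<le> (norm x)\<^sup>2"
    by simp
  then show "norm ?P \<le> norm x"
    by (rule power2_le_imp_le) simp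
  have "ip ?P (smul (ip x (e j)) (e j)) = of_real ((norm (ip x (e j)))\<^sup>2)" if "j \<in> F" for j
  proof -
    have "ip ?P (e j) = ip x (e j)"
      using that F ip_partial_expansion[OF F, of j x] by auto
    then show ?thesis
      by (simp only: ip_scale_right mult_conjugate_of_real[symmetric] mult.commute)
  qed
  then have "ip ?P ?P = of_real (\<Sum>j\<in>F. (norm (ip x (e j)))\<^sup>2)"
    by (subst (2) partial_expansion_def) (simp add: ip_sum_right)
  then have "(norm ?P)\<^sup>2 = (\<Sum>j\<in>F. (norm (ip x (e j)))\<^sup>2)"
    by (simp only: ip_self of_real_eq_iff)
  with le show "(\<Sum>j\<in>F. (norm (ip x (e j)))\<^sup>2) \<le> (norm x)\<^sup>2"
    by simp
qed

lemma partial_expansion_add: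
  "partial_expansion F (x + y) = partial_expansion F x + partial_expansion F y"
  by (simp add: partial_expansion_def ip_add_left scale_left_distrib sum.distrib)

lemma partial_expansion_scale:
  "partial_expansion F (smul c x) = smul c (partial_expansion F x)"
  by (simp add: partial_expansion_def ip_scale_left scale_sum_right)

text \<open>
  A vector of the span is reproduced exactly by all large enough partial sums. In this form the
  property passes to sums and multiples, and together with the contraction property of the partial
  sums it extends to an expansion of every vector in the closure.
\<close>

lemma partial_expansion_span:
  assumes "y \<in> span (e ` J)"
  shows "\<exists>F0. finite F0 \<and> F0 \<subseteq> J \<and>
    (\<forall>F. finite F \<and> F0 \<subseteq> F \<and> F \<subseteq> J \<longrightarrow> partial_expansion F y = y)"
    (is "?P y")
proof -
  have "span (e ` J) \<subseteq> {y. ?P y}"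
  proof (rule span_minimal)
    show "subspace {y. ?P y}"
    proof (rule subspaceI)
      show "0 \<in> {y. ?P y}"
        by (auto simp: partial_expansion_def intro!: exI[of _ "{}"])
    next
      fix x y
      assume "x \<in> {y. ?P y}" "y \<in> {y. ?P y}"
      then obtain F G where FG: "finite F" "F \<subseteq> J" "finite G" "G \<subseteq> J"
        and eq: "\<And>H. finite H \<Longrightarrow> F \<subseteq> H \<Longrightarrow> H \<subseteq> J \<Longrightarrow> partial_expansion H x = x"
          "\<And>H. finite H \<Longrightarrow> G \<subseteq> H \<Longrightarrow> H \<subseteq> J \<Longrightarrow> partial_expansion H y = y"
        unfolding mem_Collect_eq by metis
      have "partial_expansion H (x + y) = x + y" if "finite H" "F \<union> G \<subseteq> H" "H \<subseteq> J" for H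
        using that eq[of H] by (simp add: partial_expansion_add)
      then show "x + y \<in> {y. ?P y}"
        using FG by (intro CollectI exI[of _ "F \<union> G"]) simp
    next
      fix c x
      assume "x \<in> {y. ?P y}"
      then obtain F where F: "finite F" "F \<subseteq> J"
        and eq: "\<And>H. finite H \<Longrightarrow> F \<subseteq> H \<Longrightarrow> H \<subseteq> J \<Longrightarrow> partial_expansion H x = x"
        unfolding mem_Collect_eq by metis
      have "partial_expansion H (smul c x) = smul c x" if "finite H" "F \<subseteq> H" "H \<subseteq> J" for H
        using that eq[of H] by (simp add: partial_expansion_scale)
      then show "smul c x \<in> {y. ?P y}"
        using F by (intro CollectI exI[of _ F]) simp
    qed
    show "e ` J \<subseteq> {y. ?P y}"
    proof
      fix x
      assume "x \<in> e ` J"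
      then obtain k where k: "k \<in> J" "x = e k"
        by blast
      have "partial_expansion F x = x" if F: "finite F" "{k} \<subseteq> F" "F \<subseteq> J" for F
      proof -
        have "partial_expansion F x = (\<Sum>j\<in>F. if j = k then e k else 0)"
          unfolding partial_expansion_def
          using F k by (intro sum.cong) (auto simp: ip_basis)
        then show ?thesis
          using F k by simp
      qed
      then show "x \<in> {y. ?P y}"
        using k by (intro CollectI exI[of _ "{k}"]) auto
    qed
  qed
  with assms show ?thesis
    by blast
qed

lemma basis_expansion: "((\<lambda>j. smul (ip x (e j)) (e j)) has_sum x) J"
  unfolding has_sum_def
proof (rule tendstoI)
  fix \<epsilon> :: real
  assume "\<epsilon> > 0"
  moreover have "x \<in> closure (span (e ` J))"
    using onb by (simp add: orthonormal_basis_def)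
  ultimately obtain y where y: "y \<in> span (e ` J)" "dist y x < \<epsilon> / 2"
    unfolding closure_approachable by (meson half_gt_zero)
  obtain F0 where F0: "finite F0" "F0 \<subseteq> J"
    and eq: "\<And>F. finite F \<Longrightarrow> F0 \<subseteq> F \<Longrightarrow> F \<subseteq> J \<Longrightarrow> partial_expansion F y = y"
    using partial_expansion_span[OF y(1)] by metis
  have "dist (partial_expansion F x) x < \<epsilon>" if F: "finite F" "F0 \<subseteq> F" "F \<subseteq> J" for F
  proof -
    have "partial_expansion F x = partial_expansion F (x - y) + y"
      using partial_expansion_add[of F "x - y" y] eq[OF F] by simp
    then have "dist (partial_expansion F x) x \<le> norm (partial_expansion F (x - y)) + norm (y - x)"
      by (simp add: dist_norm norm_triangle_ineq add_diff_eq[symmetric])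
    also have "\<dots> \<le> norm (x - y) + norm (y - x)"
      using norm_partial_expansion_le[OF F(1,3)] by simp
    also have "\<dots> < \<epsilon>"
      using y(2) by (simp add: dist_norm norm_minus_commute)
    finally show ?thesis .
  qed
  then show "\<forall>\<^sub>F F in finite_subsets_at_top J. dist (\<Sum>j\<in>F. smul (ip x (e j)) (e j)) x < \<epsilon>"
    unfolding eventually_finite_subsets_at_top partial_expansion_def using F0 by blast
qed

text \<open>
  A finite set of index pairs is enclosed in a rectangle, whose rows are handled by Bessel's
  inequality.
\<close>

lemma Bessel_inequality_family:
  assumes F: "finite F" "F \<subseteq> I \<times> J"
  shows "(\<Sum>(i, j)\<in>F. (norm (ip (y i) (e j)))\<^sup>2) \<le> (\<Sum>i\<in>fst ` F. (norm (y i))\<^sup>2)"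
proof -
  have "(\<Sum>(i, j)\<in>F. (norm (ip (y i) (e j)))\<^sup>2)
      \<le> (\<Sum>(i, j)\<in>fst ` F \<times> snd ` F. (norm (ip (y i) (e j)))\<^sup>2)"
    using F by (intro sum_mono2) (auto simp: subset_fst_snd)
  also have "\<dots> = (\<Sum>i\<in>fst ` F. \<Sum>j\<in>snd ` F. (norm (ip (y i) (e j)))\<^sup>2)"
    by (simp add: sum.cartesian_product)
  also have "\<dots> \<le> (\<Sum>i\<in>fst ` F. (norm (y i))\<^sup>2)"
    using F by (intro sum_mono Bessel_inequality) auto
  finally show ?thesis .
qed

end

section \<open>The frame operator\<close>

context
  fixes I :: "'i set" and W :: "'i \<Rightarrow> 'a set" and \<omega> :: "'i \<Rightarrow> real" and B :: real
  assumes bessel: "fusion_bessel smul ip I W \<omega> B"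
begin

lemma fusion_closed_subspace: "i \<in> I \<Longrightarrow> closed_subspace smul (W i)"
  and fusion_summable: "(\<lambda>i. (\<omega> i)\<^sup>2 * (norm (proj ip (W i) f))\<^sup>2) summable_on I"
  using bessel by (auto simp: fusion_bessel_def)

lemma fusion_bessel_sum_le:
  assumes "finite F" "F \<subseteq> I"
  shows "(\<Sum>i\<in>F. (\<omega> i * norm (proj ip (W i) f))\<^sup>2) \<le> \<bar>B\<bar> * (norm f)\<^sup>2"
proof -
  have "(\<Sum>i\<in>F. (\<omega> i * norm (proj ip (W i) f))\<^sup>2)
      \<le> (\<Sum>\<^sub>\<infinity>i\<in>I. (\<omega> i)\<^sup>2 * (norm (proj ip (W i) f))\<^sup>2)"
    unfolding power_mult_distrib
    using assms fusion_summable by (intro finite_sum_le_infsum) auto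
  also have "\<dots> \<le> B * (norm f)\<^sup>2"
    using bessel by (simp add: fusion_bessel_def)
  also have "\<dots> \<le> \<bar>B\<bar> * (norm f)\<^sup>2"
    by (intro mult_right_mono) auto
  finally show ?thesis .
qed

text \<open>
  The projections satisfy \<open>\<langle>\<pi> f, v\<rangle> = \<langle>\<pi> f, \<pi> v\<rangle>\<close>, so each term pairs with \<open>v\<close> to at most
  \<open>\<omega> i \<parallel>\<pi> f\<parallel> \<cdot> \<omega> i \<parallel>\<pi> v\<parallel>\<close>, and both factors are square summable by the Bessel condition.
\<close>

lemma
  shows frame_operator_has_sum:
      "((\<lambda>i. (\<omega> i)\<^sup>2 *\<^sub>R proj ip (W i) f) has_sum frame_operator ip I W \<omega> f) I"
    and norm_frame_operator_le: "norm (frame_operator ip I W \<omega> f) \<le> \<bar>B\<bar> * norm f"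
proof -
  let ?u = "\<lambda>i. (\<omega> i)\<^sup>2 *\<^sub>R proj ip (W i) f"
  have sq: "(\<lambda>i. (\<omega> i * norm (proj ip (W i) f))\<^sup>2) summable_on I"
    using fusion_summable by (simp add: power_mult_distrib)
  have dom: "norm (ip (?u i) v)
      \<le> (\<omega> i * norm (proj ip (W i) f)) * (\<omega> i * norm (proj ip (W i) v))" if i: "i \<in> I" for i v
  proof -
    note W = fusion_closed_subspace[OF i]
    have "ip (?u i) v = of_real ((\<omega> i)\<^sup>2) * ip (proj ip (W i) f) (proj ip (W i) v)"
      by (simp add: ip_scaleR_left proj_ip_right[OF W proj_mem[OF W]])
    then have "norm (ip (?u i) v) = (\<omega> i)\<^sup>2 * norm (ip (proj ip (W i) f) (proj ip (W i) v))"
      by (simp add: norm_mult norm_power)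
    also have "\<dots> \<le> (\<omega> i)\<^sup>2 * (norm (proj ip (W i) f) * norm (proj ip (W i) v))"
      by (intro mult_left_mono Cauchy_Schwarz) simp
    finally show ?thesis
      by (simp add: power2_eq_square mult_ac)
  qed
  have "?u summable_on I"
    by (rule Bessel_synthesis_summable[OF sq dom _ fusion_bessel_sum_le]) auto
  then show sum: "(?u has_sum frame_operator ip I W \<omega> f) I"
    unfolding frame_operator_def by (rule has_sum_infsum)
  show "norm (frame_operator ip I W \<omega> f) \<le> \<bar>B\<bar> * norm f"
  proof (rule norm_has_sum_le[OF sum])
    fix F
    assume F: "finite F" "F \<subseteq> I"
    have "(norm (sum ?u F))\<^sup>2 \<le> \<bar>B\<bar> * (\<Sum>i\<in>F. (\<omega> i * norm (proj ip (W i) f))\<^sup>2)"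
      by (rule Bessel_synthesis_bound[OF sq dom _ fusion_bessel_sum_le F]) auto
    also have "\<dots> \<le> \<bar>B\<bar> * (\<bar>B\<bar> * (norm f)\<^sup>2)"
      using F by (intro mult_left_mono fusion_bessel_sum_le) auto
    also have "\<dots> = (\<bar>B\<bar> * norm f)\<^sup>2"
      by (simp add: power2_eq_square mult_ac)
    finally show "norm (sum ?u F) \<le> \<bar>B\<bar> * norm f"
      by (rule power2_le_imp_le) simp
  qed
qed

lemma bounded_linear_on_frame_operator:
  "bounded_linear_on UNIV (frame_operator ip I W \<omega>) \<bar>B\<bar>"
proof -
  let ?S = "frame_operator ip I W \<omega>"
  note P = bounded_linear_on_proj[OF fusion_closed_subspace, unfolded bounded_linear_on_def]
  have "?S (x + y) = ?S x + ?S y" for x y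
  proof (rule has_sum_unique[OF frame_operator_has_sum])
    have "((\<lambda>i. (\<omega> i)\<^sup>2 *\<^sub>R proj ip (W i) x + (\<omega> i)\<^sup>2 *\<^sub>R proj ip (W i) y) has_sum ?S x + ?S y) I"
      by (intro has_sum_add frame_operator_has_sum)
    then show "((\<lambda>i. (\<omega> i)\<^sup>2 *\<^sub>R proj ip (W i) (x + y)) has_sum ?S x + ?S y) I"
      by (rule has_sum_cong[THEN iffD1, rotated]) (use P in \<open>auto simp: scaleR_add_right\<close>)
  qed
  moreover have "?S (smul c x) = smul c (?S x)" for c x
  proof (rule has_sum_unique[OF frame_operator_has_sum])
    have "bounded_linear (smul c)"
      by (rule bounded_linear_intro[of _ "norm c"])
        (auto simp: scale_right_distrib norm_smul scale_of_real[symmetric] mult_ac)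
    then have "((\<lambda>i. smul c ((\<omega> i)\<^sup>2 *\<^sub>R proj ip (W i) x)) has_sum smul c (?S x)) I"
      by (rule has_sum_bounded_linear[OF _ frame_operator_has_sum])
    then show "((\<lambda>i. (\<omega> i)\<^sup>2 *\<^sub>R proj ip (W i) (smul c x)) has_sum smul c (?S x)) I"
      by (rule has_sum_cong[THEN iffD1, rotated])
        (use P in \<open>auto simp: scale_of_real[symmetric] mult.commute simp del: of_real_power\<close>)
  qed
  ultimately show ?thesis
    using norm_frame_operator_le by (simp add: bounded_linear_on_def)
qed

lemma ip_frame_operator_self:
  "ip (frame_operator ip I W \<omega> f) f
    = of_real (\<Sum>\<^sub>\<infinity>i\<in>I. (\<omega> i)\<^sup>2 * (norm (proj ip (W i) f))\<^sup>2)"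
proof (rule has_sum_unique)
  show "((\<lambda>i. ip ((\<omega> i)\<^sup>2 *\<^sub>R proj ip (W i) f) f) has_sum ip (frame_operator ip I W \<omega> f) f) I"
    by (rule has_sum_bounded_linear[OF bounded_linear_ip_left frame_operator_has_sum])
  have "ip ((\<omega> i)\<^sup>2 *\<^sub>R proj ip (W i) f) f = of_real ((\<omega> i)\<^sup>2 * (norm (proj ip (W i) f))\<^sup>2)"
    if i: "i \<in> I" for i
  proof -
    note W = fusion_closed_subspace[OF i]
    have "ip (proj ip (W i) f) f = ip (proj ip (W i) f) (proj ip (W i) f)"
      by (simp add: proj_ip_right[OF W proj_mem[OF W]])
    then show ?thesis
      by (simp only: ip_scaleR_left ip_self of_real_mult)
  qed
  then show "((\<lambda>i. ip ((\<omega> i)\<^sup>2 *\<^sub>R proj ip (W i) f) f) has_sum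
      of_real (\<Sum>\<^sub>\<infinity>i\<in>I. (\<omega> i)\<^sup>2 * (norm (proj ip (W i) f))\<^sup>2)) I"
    using has_sum_of_real[OF has_sum_infsum[OF fusion_summable], where 'a = 'k]
    by (subst has_sum_cong) auto
qed

text \<open>
  The coefficients of \<open>f\<close> at the vectors with first index \<open>i\<close> are the basis coefficients of
  \<open>\<omega> i \<pi>\<^bsub>W i\<^esub> f\<close>, so Bessel's inequality reduces the claim to the Bessel condition for the subspaces.
\<close>

lemma bessel_sequence_basis_projections:
  assumes onb: "orthonormal_basis smul ip J e"
  shows "bessel_sequence ip (I \<times> J) (\<lambda>(i, j). \<omega> i *\<^sub>R proj ip (W i) (e j))"
proof -
  let ?g = "\<lambda>(i, j). \<omega> i *\<^sub>R proj ip (W i) (e j)"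
  have le: "(\<Sum>k\<in>F. (norm (ip f (?g k)))\<^sup>2) \<le> \<bar>B\<bar> * (norm f)\<^sup>2"
    if F: "finite F" "F \<subseteq> I \<times> J" for F f
  proof -
    have "(\<Sum>k\<in>F. (norm (ip f (?g k)))\<^sup>2)
        = (\<Sum>(i, j)\<in>F. (norm (ip (\<omega> i *\<^sub>R proj ip (W i) f) (e j)))\<^sup>2)"
      using F fusion_closed_subspace
      by (intro sum.cong) (auto simp: ip_scaleR_left ip_scaleR_right proj_self_adjoint)
    also have "\<dots> \<le> (\<Sum>i\<in>fst ` F. (norm (\<omega> i *\<^sub>R proj ip (W i) f))\<^sup>2)"
      by (rule Bessel_inequality_family[OF onb F])
    also have "\<dots> = (\<Sum>i\<in>fst ` F. (\<omega> i * norm (proj ip (W i) f))\<^sup>2)"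
      by (simp add: power_mult_distrib)
    also have "\<dots> \<le> \<bar>B\<bar> * (norm f)\<^sup>2"
      using F by (intro fusion_bessel_sum_le) auto
    finally show ?thesis .
  qed
  have sm: "(\<lambda>k. (norm (ip f (?g k)))\<^sup>2) summable_on I \<times> J" for f
    using le by (intro nonneg_bdd_above_summable_on bdd_aboveI[of _ "\<bar>B\<bar> * (norm f)\<^sup>2"]) auto
  show ?thesis
    unfolding bessel_sequence_def
    using sm infsum_le_finite_sums[OF sm le] by blast
qed

end

text \<open>
  On \<open>R(K)\<close> the lower frame bound becomes a lower bound in \<open>\<parallel>f\<parallel>\<close>, because \<open>K\<^sup>*\<close> is bounded below there:
  \<open>A \<parallel>f\<parallel>\<^sup>2 \<le> C\<^sup>2 A \<parallel>K\<^sup>* f\<parallel>\<^sup>2 \<le> C\<^sup>2 \<langle>S f, f\<rangle> \<le> C\<^sup>2 \<parallel>S f\<parallel> \<parallel>f\<parallel>\<close>.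
\<close>

lemma frame_operator_bounded_below:
  assumes K: "bounded_linear_on UNIV K C0" and clo: "closed (range K)"
    and frame: "K_fusion_frame smul ip K I W \<omega> A B"
  shows "\<exists>c>0. \<forall>f\<in>range K. norm f \<le> c * norm (frame_operator ip I W \<omega> f)"
proof -
  let ?S = "frame_operator ip I W \<omega>" and ?K' = "adj_on ip UNIV K"
  have bessel: "fusion_bessel smul ip I W \<omega> B" and A: "A > 0"
    and lower: "\<And>f. A * (norm (?K' f))\<^sup>2 \<le> (\<Sum>\<^sub>\<infinity>i\<in>I. (\<omega> i)\<^sup>2 * (norm (proj ip (W i) f))\<^sup>2)"
    using frame by (auto simp: K_fusion_frame_def)
  obtain C where C: "C > 0" "\<And>f. f \<in> range K \<Longrightarrow> norm f \<le> C * norm (?K' f)"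
    using adjoint_bounded_below_on_closed_range[OF K clo] by blast
  have "norm f \<le> C\<^sup>2 / A * norm (?S f)" if f: "f \<in> range K" for f
  proof (cases "f = 0")
    case True
    then show ?thesis
      using A by simp
  next
    case False
    have "A * (norm (?K' f))\<^sup>2 \<le> norm (ip (?S f) f)"
      using lower[of f] by (simp add: ip_frame_operator_self[OF bessel])
    also have "\<dots> \<le> norm (?S f) * norm f"
      by (rule Cauchy_Schwarz)
    finally have S: "A * (norm (?K' f))\<^sup>2 \<le> norm (?S f) * norm f" .
    have "A * (norm f)\<^sup>2 \<le> A * (C * norm (?K' f))\<^sup>2"
      using A C(2)[OF f] by (intro mult_left_mono power_mono) auto
    also have "\<dots> = C\<^sup>2 * (A * (norm (?K' f))\<^sup>2)"
      by (simp add: power_mult_distrib)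
    also have "\<dots> \<le> C\<^sup>2 * (norm (?S f) * norm f)"
      by (intro mult_left_mono S) simp
    finally have "(A * norm f) * norm f \<le> (C\<^sup>2 * norm (?S f)) * norm f"
      by (simp add: power2_eq_square mult_ac)
    then have "A * norm f \<le> C\<^sup>2 * norm (?S f)"
      using False by simp
    then show ?thesis
      using A by (simp add: field_simps)
  qed
  then show ?thesis
    using A C(1) by (intro exI[of _ "C\<^sup>2 / A"]) auto
qed

text \<open>
  The lower bound for \<open>S\<^sub>W\<close> on \<open>R(K)\<close> makes \<open>S\<^sub>W(R(K))\<close> closed and \<open>S\<^sub>W\<^sup>-\<^sup>1\<close> bounded on it, which is what
  the adjoint of \<open>S\<^sub>W\<^sup>-\<^sup>1\<close> needs in order to exist.
\<close>

lemma bounded_linear_on_frame_inv_adj: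
  assumes K: "bounded_linear_on UNIV K C0" and clo: "closed (range K)"
    and frame: "K_fusion_frame smul ip K I W \<omega> A B"
  shows "\<exists>c. bounded_linear_on UNIV (frame_inv_adj ip K I W \<omega>) c"
proof -
  have R: "closed_subspace smul (range K)"
    using subspace_image[OF subspace_UNIV K] clo by (simp add: closed_subspace_def)
  have "fusion_bessel smul ip I W \<omega> B"
    using frame by (simp add: K_fusion_frame_def)
  note S = bounded_linear_on_frame_operator[OF this]
  obtain c where c: "c > 0"
    "\<And>f. f \<in> range K \<Longrightarrow> norm f \<le> c * norm (frame_operator ip I W \<omega> f)"
    using frame_operator_bounded_below[OF K clo frame] by blast
  show ?thesis
    unfolding frame_inv_adj_def
    using bounded_linear_on_adj_on[OF closed_subspace_image[OF R S c]
        bounded_linear_on_inv_into[OF R S c]]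
    by blast
qed

section \<open>The two dual conditions\<close>

text \<open>
  Moving the operators to the other side of the inner product turns the pairing at \<open>(i, j)\<close>, up to
  conjugation, into the coefficient of \<open>\<omega> i L\<^sup>* \<pi>\<^bsub>W i\<^esub> \<pi>\<^sub>U v\<close> at \<open>e j\<close>. Bessel's inequality removes the basis, and the Bessel
  condition for \<open>W\<close> at \<open>\<pi>\<^sub>U v\<close> bounds what remains.
\<close>

lemma frame_family_Bessel:
  assumes onb: "orthonormal_basis smul ip J e"
    and bessel: "fusion_bessel smul ip I W \<omega> B"
    and U: "closed_subspace smul U" and L: "bounded_linear_on UNIV L D"
    and F: "finite F" "F \<subseteq> I \<times> J"
  shows "(\<Sum>(i, j)\<in>F. (norm (ip (\<omega> i *\<^sub>R proj ip U (proj ip (W i) (L (e j)))) v))\<^sup>2)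
    \<le> D\<^sup>2 * \<bar>B\<bar> * (norm v)\<^sup>2"
proof -
  let ?L' = "adj_on ip UNIV L"
  note ipL = ip_adj_on[OF closed_subspace_UNIV L UNIV_I]
  have L': "norm (?L' x) \<le> D * norm x" for x
    using bounded_linear_on_adj_on[OF closed_subspace_UNIV L] by (simp add: bounded_linear_on_def)
  let ?y = "\<lambda>i. \<omega> i *\<^sub>R ?L' (proj ip (W i) (proj ip U v))"
  have "(\<Sum>(i, j)\<in>F. (norm (ip (\<omega> i *\<^sub>R proj ip U (proj ip (W i) (L (e j)))) v))\<^sup>2)
      = (\<Sum>(i, j)\<in>F. (norm (ip (?y i) (e j)))\<^sup>2)"
  proof (intro sum.cong refl, clarify)
    fix i j
    assume "(i, j) \<in> F"
    then have W: "closed_subspace smul (W i)"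
      using F fusion_closed_subspace[OF bessel] by blast
    have "ip (\<omega> i *\<^sub>R proj ip U (proj ip (W i) (L (e j)))) v = ip (e j) (?y i)"
      by (simp add: ip_scaleR_left ip_scaleR_right proj_self_adjoint[OF U]
          proj_self_adjoint[OF W] ipL)
    then show "(norm (ip (\<omega> i *\<^sub>R proj ip U (proj ip (W i) (L (e j)))) v))\<^sup>2
        = (norm (ip (?y i) (e j)))\<^sup>2"
      by (simp only: norm_ip_commute)
  qed
  also have "\<dots> \<le> (\<Sum>i\<in>fst ` F. (norm (?y i))\<^sup>2)"
    by (rule Bessel_inequality_family[OF onb F])
  also have "\<dots> \<le> (\<Sum>i\<in>fst ` F. D\<^sup>2 * (\<omega> i * norm (proj ip (W i) (proj ip U v)))\<^sup>2)"
  proof (rule sum_mono)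
    fix i
    have "(norm (?y i))\<^sup>2 = (\<omega> i)\<^sup>2 * (norm (?L' (proj ip (W i) (proj ip U v))))\<^sup>2"
      by (simp add: power_mult_distrib)
    also have "\<dots> \<le> (\<omega> i)\<^sup>2 * (D * norm (proj ip (W i) (proj ip U v)))\<^sup>2"
      using L' by (intro mult_left_mono power_mono) auto
    finally show "(norm (?y i))\<^sup>2 \<le> D\<^sup>2 * (\<omega> i * norm (proj ip (W i) (proj ip U v)))\<^sup>2"
      by (simp add: power_mult_distrib mult_ac)
  qed
  also have "\<dots> = D\<^sup>2 * (\<Sum>i\<in>fst ` F. (\<omega> i * norm (proj ip (W i) (proj ip U v)))\<^sup>2)"
    by (simp add: sum_distrib_left)
  also have "\<dots> \<le> D\<^sup>2 * (\<bar>B\<bar> * (norm (proj ip U v))\<^sup>2)"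
    using F by (intro mult_left_mono fusion_bessel_sum_le[OF bessel]) auto
  also have "\<dots> \<le> D\<^sup>2 * (\<bar>B\<bar> * (norm v)\<^sup>2)"
    using bounded_linear_on_proj[OF U]
    by (intro mult_left_mono power_mono) (auto simp: bounded_linear_on_def)
  finally show ?thesis
    by (simp add: mult.assoc)
qed

text \<open>
  The coefficients are \<open>\<upsilon>\<close> times those of \<open>\<pi>\<^sub>V f\<close>, so this is the expansion of \<open>\<pi>\<^sub>V f\<close> in the basis,
  mapped by \<open>\<omega> \<upsilon> T\<close>. It evaluates one row of the double series.
\<close>

lemma iterated_expansion:
  assumes onb: "orthonormal_basis smul ip J e" and T: "bounded_linear_on UNIV T C"
    and V: "closed_subspace smul V"
  shows "((\<lambda>j. smul (ip f (\<upsilon> *\<^sub>R proj ip V (e j))) (\<omega> *\<^sub>R T (e j))) has_sum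
    (\<omega> * \<upsilon>) *\<^sub>R T (proj ip V f)) J"
proof -
  interpret T: bounded_linear T
    by (rule bounded_linear_on_bounded_linear[OF T])
  have "((\<lambda>j. (\<omega> * \<upsilon>) *\<^sub>R T (smul (ip (proj ip V f) (e j)) (e j))) has_sum
      (\<omega> * \<upsilon>) *\<^sub>R T (proj ip V f)) J"
    by (intro has_sum_scaleR has_sum_bounded_linear[OF T.bounded_linear_axioms]
        basis_expansion[OF onb])
  moreover have "(\<omega> * \<upsilon>) *\<^sub>R T (smul (ip (proj ip V f) (e j)) (e j))
      = smul (ip f (\<upsilon> *\<^sub>R proj ip V (e j))) (\<omega> *\<^sub>R T (e j))" for j
  proof -
    have "T (smul c (e j)) = smul c (T (e j))" for c
      using T by (simp add: bounded_linear_on_def)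
    moreover have "ip f (\<upsilon> *\<^sub>R proj ip V (e j)) = of_real \<upsilon> * ip (proj ip V f) (e j)"
      by (simp only: ip_scaleR_right proj_self_adjoint[OF V])
    ultimately show ?thesis
      by (simp add: scale_of_real[symmetric] mult_ac)
  qed
  ultimately show ?thesis
    by simp
qed

end

theorem theorem3p17:
  fixes smul :: "'k::hilbert_scalar \<Rightarrow> 'a::banach \<Rightarrow> 'a"
    and ip :: "'a \<Rightarrow> 'a \<Rightarrow> 'k"
    and J :: "'j set" and e :: "'j \<Rightarrow> 'a"
    and K :: "'a \<Rightarrow> 'a"
    and I :: "'i set"
    and W V :: "'i \<Rightarrow> 'a set" and \<omega> \<upsilon> :: "'i \<Rightarrow> real"
    and A B :: real
  assumes "hilbert_space smul ip"
    and "separable_space (euclidean :: 'a topology)"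
    and "orthonormal_basis smul ip J e"
    and "bounded_operator smul K"
    and "closed (range K)"
    and "countable I"
    and "K_fusion_frame smul ip K I W \<omega> A B"
    and "bessel_fusion_sequence smul ip I V \<upsilon>"
  shows "fusion_K_dual smul ip K I W \<omega> V \<upsilon> \<longleftrightarrow>
    vector_K_dual smul ip K (I \<times> J)
      (\<lambda>(i, j). \<omega> i *\<^sub>R proj ip (range K) (proj ip (W i) (frame_inv_adj ip K I W \<omega> (K (e j)))))
      (\<lambda>(i, j). \<upsilon> i *\<^sub>R proj ip (V i) (e j))"
proof -
  interpret hilbert_space smul ip
    by (rule assms(1))
  note onb = assms(3) and Kop = assms(4) and clo = assms(5) and frame = assms(7) and V = assms(8)
  obtain B' where B': "fusion_bessel smul ip I V \<upsilon> B'"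
    using V by (auto simp: bessel_fusion_sequence_def)
  have B: "fusion_bessel smul ip I W \<omega> B"
    using frame by (simp add: K_fusion_frame_def)
  obtain C0 where K: "bounded_linear_on UNIV K C0"
    using bounded_operator_bounded_linear_on[OF Kop] .
  have R: "closed_subspace smul (range K)"
    using subspace_image[OF subspace_UNIV K] clo by (simp add: closed_subspace_def)
  define L where "L x = frame_inv_adj ip K I W \<omega> (K x)" for x
  obtain D where L: "bounded_linear_on UNIV L D"
    using bounded_linear_on_frame_inv_adj[OF K clo frame] bounded_linear_on_comp[OF _ K]
    unfolding L_def by blast
  define T where "T i x = proj ip (range K) (proj ip (W i) (L x))" for i x
  define g where "g = (\<lambda>(i, j). \<upsilon> i *\<^sub>R proj ip (V i) (e j))"
  define h where "h = (\<lambda>(i, j). \<omega> i *\<^sub>R T i (e j))"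
  have g: "bessel_sequence ip (I \<times> J) g"
    unfolding g_def by (rule bessel_sequence_basis_projections[OF B' onb])
  have inner: "((\<lambda>j. smul (ip f (g (i, j))) (h (i, j))) has_sum
      (\<omega> i * \<upsilon> i) *\<^sub>R T i (proj ip (V i) f)) J" if i: "i \<in> I" for f i
  proof -
    have "bounded_linear_on UNIV (T i) (1 * (1 * D))"
      unfolding T_def
      by (intro bounded_linear_on_comp bounded_linear_on_proj R L fusion_closed_subspace[OF B i])
    then show ?thesis
      unfolding g_def h_def prod.case
      by (rule iterated_expansion[OF onb _ fusion_closed_subspace[OF B' i]])
  qed
  \<comment> \<open>The coefficients are square summable as \<open>g\<close> is Bessel, and \<open>h\<close> is Bessel too, so the double
    series converges whether or not the duality holds.\<close>
  have summable: "(\<lambda>k. smul (ip f (g k)) (h k)) summable_on I \<times> J" for f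
  proof (rule Bessel_synthesis_summable)
    show "(\<lambda>k. (norm (ip f (g k)))\<^sup>2) summable_on I \<times> J"
      using g by (auto simp: bessel_sequence_def)
    show "norm (ip (smul (ip f (g k)) (h k)) v) \<le> norm (ip f (g k)) * norm (ip (h k) v)" for k v
      by (simp add: ip_scale_left norm_mult)
    show "(\<Sum>k\<in>F. (norm (ip (h k) v))\<^sup>2) \<le> D\<^sup>2 * \<bar>B\<bar> * (norm v)\<^sup>2"
      if "finite F" "F \<subseteq> I \<times> J" for F v
      using frame_family_Bessel[OF onb B R L that, of v]
      by (simp add: h_def T_def case_prod_unfold)
  qed simp
  \<comment> \<open>Row sums always exist; only the step from iterated to double sums uses summability.\<close>
  have "((\<lambda>i. (\<omega> i * \<upsilon> i) *\<^sub>R T i (proj ip (V i) f)) has_sum K f) I \<longleftrightarrow>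
      ((\<lambda>k. smul (ip f (g k)) (h k)) has_sum K f) (I \<times> J)" for f
    using has_sum_SigmaD[OF _ inner] has_sum_SigmaI[OF inner _ summable] by blast
  then show ?thesis
    using V g unfolding fusion_K_dual_def vector_K_dual_def
    by (simp add: T_def L_def g_def h_def)
qed

end
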